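(* Let $T$ be a terrain with vertex set $V$, let $C \subset T$ be a finite guard cover of $T$, possibly of minimum cardinality, and let $$U := V \cup \bigcup_{v \in V} \{ p \mid p \text{ is extremal in } \mathcal{V}(v) \}.$$ Then there exists a guard cover $C' \subseteq U$ of $T$ with $|C'| = |C|$.
   Context: A terrain $T$ is an $x$-monotone polygonal chain in the plane defined by its vertices $V = \{v_1,\dots,v_n\}$, with edges $e_i = \overline{v_i v_{i+1}}$, $1 \le i \le n-1$. A point $p \in T$ sees (covers) $q \in T$ iff the segment $\overline{pq}$ is nowhere below $T$. The visibility region of $p \in T$ is $\mathcal{V}(p) = \{ q \in T \mid p \text{ sees } q\}$, and $\mathcal{V}(G) = \bigcup_{g\in G}\mathcal{V}(g)$ for $G \subseteq T$. A set $G \subseteq T$ with $\mathcal{V}(G) = T$ is called a guard cover of $T$. A point $q \in \mathcal{V}(p)$ is extremal in $\mathcal{V}(p)$ if it has maximal or minimal $x$-coordinate within its connected component of $\mathcal{V}(p)$.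
   Formalization: The equality |C'| = |C| is claimed only when U has at least |C| elements, and |C'| ≤ |C| in general: for a single edge U has two points, so a guard cover C of three points admits no C' ⊆ U of equal size. *)

theory Defs
  imports "HOL-Analysis.Analysis"
begin

type_synonym point = "real \<times> real"

text \<open>A terrain is given by the list of its vertices, from left to right. Monotonicity is strict:
  there are no vertical edges, so points of the terrain are determined by their first coordinate.\<close>

definition terrain_vertices :: "point list \<Rightarrow> bool" where
  "terrain_vertices vs \<longleftrightarrow> vs \<noteq> [] \<and> sorted_wrt (\<lambda>p q. fst p < fst q) vs"

text \<open>The union with the vertex set only matters for a single vertex, where there are no edges.\<close>

definition terrain :: "point list \<Rightarrow> point set" where
  "terrain vs = set vs \<union> (\<Union>i<length vs - 1. closed_segment (vs ! i) (vs ! Suc i))"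

definition nowhere_below :: "point set \<Rightarrow> point set \<Rightarrow> bool" where
  "nowhere_below S T \<longleftrightarrow> (\<forall>s\<in>S. \<forall>t\<in>T. fst t = fst s \<longrightarrow> snd t \<le> snd s)"

definition sees :: "point set \<Rightarrow> point \<Rightarrow> point \<Rightarrow> bool" where
  "sees T p q \<longleftrightarrow> p \<in> T \<and> q \<in> T \<and> nowhere_below (closed_segment p q) T"

definition visibility :: "point set \<Rightarrow> point \<Rightarrow> point set" where
  "visibility T p = {q \<in> T. sees T p q}"

definition guard_cover :: "point set \<Rightarrow> point set \<Rightarrow> bool" where
  "guard_cover T G \<longleftrightarrow> G \<subseteq> T \<and> (\<Union>g\<in>G. visibility T g) = T"

definition extremal :: "point set \<Rightarrow> point \<Rightarrow> point \<Rightarrow> bool" where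
  "extremal T p q \<longleftrightarrow> q \<in> visibility T p \<and>
     ((\<forall>r \<in> connected_component_set (visibility T p) q. fst r \<le> fst q) \<or>
      (\<forall>r \<in> connected_component_set (visibility T p) q. fst q \<le> fst r))"

definition guard_candidates :: "point list \<Rightarrow> point set" where
  "guard_candidates vs = set vs \<union> (\<Union>v\<in>set vs. {p. extremal (terrain vs) v p})"

end

theory Submission
  imports Defs
begin

text \<open>Guards outside the candidate set are replaced one at a time. Let such a guard \<open>g\<close> lie in the
  interior of the edge \<open>ab\<close>. Everything that \<open>g\<close> sees beyond one end of the edge remains visible when
  \<open>g\<close> moves on the edge towards the other end. Moving \<open>g\<close> left to a candidate \<open>l\<close> that sees the same
  vertices loses a point \<open>q\<close> to the left of the edge only if \<open>g\<close> sees the edge of \<open>q\<close> partially. If no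
  other guard sees \<open>q\<close>, the remainder of that edge is covered by guards to the left of it, and by
  connectedness one of these, \<open>h\<close>, sees a point \<open>m\<close> right of \<open>q\<close> that \<open>g\<close> also sees. A point \<open>z\<close> that
  \<open>g\<close> sees beyond \<open>b\<close> is seen by \<open>q\<close>, since \<open>q\<close> and \<open>z\<close> are above the line of the edge \<open>ab\<close>; as \<open>h\<close>
  sees \<open>m\<close>, the order claim for \<open>h, q, m, z\<close> shows that \<open>h\<close> sees \<open>z\<close>. So \<open>g\<close> can be moved right to \<open>b\<close>.\<close>

section \<open>Segments, and visibility as a slope inequality\<close>

lemma mem_segment_fst:
  fixes a b :: point
  assumes "fst a < fst b" "z \<in> closed_segment a b"
  shows "fst a \<le> fst z" "fst z \<le> fst b"
    "snd z = snd a + (snd b - snd a) / (fst b - fst a) * (fst z - fst a)"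
proof -
  obtain u where u: "0 \<le> u" "u \<le> 1" and z: "z = (1 - u) *\<^sub>R a + u *\<^sub>R b"
    using assms(2) by (auto simp: closed_segment_def)
  have f: "fst z = fst a + u * (fst b - fst a)" and s: "snd z = snd a + u * (snd b - snd a)"
    unfolding z by (auto simp: algebra_simps)
  show "fst a \<le> fst z" using f u assms(1) by simp
  have "u * (fst b - fst a) \<le> 1 * (fst b - fst a)"
    using u assms(1) by (intro mult_right_mono) auto
  then show "fst z \<le> fst b" using f by simp
  show "snd z = snd a + (snd b - snd a) / (fst b - fst a) * (fst z - fst a)"
    using f s assms(1) by simp
qed

lemma segment_hits_fst:
  fixes a b :: point
  assumes "fst a < fst b" "fst a \<le> x" "x \<le> fst b"
  shows "\<exists>z\<in>closed_segment a b. fst z = x"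
proof -
  have "x \<in> closed_segment (fst a) (fst b)"
    using assms by (simp add: closed_segment_eq_real_ivl)
  also have "\<dots> = fst ` closed_segment a b"
    by (rule closed_segment_linear_image) (rule linear_fst)
  finally show ?thesis by auto
qed

lemma sees_commute: "sees T p q \<longleftrightarrow> sees T q p"
  by (auto simp: sees_def closed_segment_commute)

lemma sees_in: "sees T p q \<Longrightarrow> p \<in> T" "sees T p q \<Longrightarrow> q \<in> T"
  by (auto simp: sees_def)

text \<open>Multiplying out the slopes frees later arguments of division. Above the two ends of the
  segment, injectivity of \<open>fst\<close> leaves only \<open>p\<close> and \<open>q\<close>
  themselves, so only points strictly between matter.\<close>

lemma sees_less_iff:
  assumes inj: "inj_on fst T" and lt: "fst p < fst q"
  shows "sees T p q \<longleftrightarrow> p \<in> T \<and> q \<in> T \<and>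
    (\<forall>t\<in>T. fst p < fst t \<and> fst t < fst q \<longrightarrow>
       (snd t - snd p) * (fst q - fst p) \<le> (snd q - snd p) * (fst t - fst p))"
    (is "?L \<longleftrightarrow> ?R")
proof
  assume L: ?L
  have "(snd t - snd p) * (fst q - fst p) \<le> (snd q - snd p) * (fst t - fst p)"
    if t: "t \<in> T" "fst p < fst t" "fst t < fst q" for t
  proof -
    obtain z where z: "z \<in> closed_segment p q" "fst z = fst t"
      using segment_hits_fst[OF lt] t by (metis less_imp_le)
    then have "snd t \<le> snd z" using L t by (auto simp: sees_def nowhere_below_def)
    also have "snd z = snd p + (snd q - snd p) / (fst q - fst p) * (fst t - fst p)"
      using mem_segment_fst(3)[OF lt z(1)] z(2) by simp
    finally show ?thesis using lt by (simp add: field_simps)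
  qed
  then show ?R using L by (auto simp: sees_def)
next
  assume R: ?R
  have "snd t \<le> snd z" if z: "z \<in> closed_segment p q" and t: "t \<in> T" "fst t = fst z" for z t
  proof -
    note m = mem_segment_fst[OF lt z]
    consider "fst t = fst p" | "fst t = fst q" | "fst p < fst t" "fst t < fst q"
      using m t by linarith
    then show ?thesis
    proof cases
      case 1
      then have "t = p" using inj R t by (auto dest: inj_onD)
      then show ?thesis using m(3) t by simp
    next
      case 2
      then have "t = q" using inj R t by (auto dest: inj_onD)
      then show ?thesis using m(3) t lt by simp
    next
      case 3
      then have "(snd t - snd p) * (fst q - fst p) \<le> (snd q - snd p) * (fst t - fst p)"
        using R t by blast
      then have "snd t - snd p \<le> (snd q - snd p) * (fst t - fst p) / (fst q - fst p)"
        using lt by (simp add: pos_le_divide_eq)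
      then show ?thesis using m(3) t by simp
    qed
  qed
  then show ?L using R by (auto simp: sees_def nowhere_below_def)
qed

lemma sees_refl:
  assumes "inj_on fst T" "p \<in> T"
  shows "sees T p p"
  using assms by (auto simp: sees_def nowhere_below_def dest: inj_onD)

lemma segment_of_inj:
  fixes a b :: point
  assumes "inj_on fst T" "closed_segment a b \<subseteq> T" "fst a < fst b" "t \<in> T"
    "fst a \<le> fst t" "fst t \<le> fst b"
  shows "t \<in> closed_segment a b"
proof -
  obtain z where z: "z \<in> closed_segment a b" "fst z = fst t"
    using segment_hits_fst assms(3,5,6) by blast
  then have "z = t" using assms(1,2,4) by (auto dest: inj_onD)
  then show ?thesis using z by simp
qed

section \<open>Visibility of points on one edge\<close>

lemma sees_same_edge:
  assumes inj: "inj_on fst T" and ab: "closed_segment a b \<subseteq> T"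
    and p: "p \<in> closed_segment a b" and q: "q \<in> closed_segment a b"
  shows "sees T p q"
proof -
  have "closed_segment p q \<subseteq> T"
    using ab p q by (meson convex_closed_segment closed_segment_subset order_trans)
  then show ?thesis
    using inj by (auto simp: sees_def nowhere_below_def dest: inj_onD)
qed

text \<open>A point to the left of an edge that sees some point \<open>g\<^sub>0\<close> of it other than the left endpoint lies
  on or above the line of the edge; hence its view of the edge is closed under moving right.\<close>

lemma sees_edge_rightwards:
  assumes inj: "inj_on fst T" and ab: "closed_segment a b \<subseteq> T" "fst a < fst b"
    and pa: "fst p \<le> fst a"
    and g0: "g\<^sub>0 \<in> closed_segment a b" "fst a < fst g\<^sub>0" "sees T p g\<^sub>0"
    and g: "g \<in> closed_segment a b" "sees T p g"
    and g': "g' \<in> closed_segment a b" "fst g \<le> fst g'"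
  shows "sees T p g'"
proof (cases "fst p = fst a")
  case True
  have "p \<in> T" "a \<in> T" using sees_in[OF g0(3)] ab by auto
  then have "p = a" using True inj by (auto dest: inj_onD)
  then show ?thesis using sees_same_edge[OF inj ab(1)] g' by auto
next
  case False
  define s where "s = (snd b - snd a) / (fst b - fst a)"
  have line: "snd z = snd a + s * (fst z - fst a)" if "z \<in> closed_segment a b" for z
    using mem_segment_fst(3)[OF ab(2) that] by (simp add: s_def)
  \<comment> \<open>\<open>d\<close> is the vertical height of \<open>p\<close> above the line
    through the edge, and \<open>s\<close> is the slope of that line.\<close>
  define d where "d = snd p - snd a + s * (fst a - fst p)"
  have rel: "snd z - snd p = s * (fst z - fst p) - d" if "z \<in> closed_segment a b" for z
    using line[OF that] by (simp add: d_def algebra_simps)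
  have lt: "fst p < fst a" using False pa by simp
  have bounds: "fst a \<le> fst z" "fst z \<le> fst b" if "z \<in> closed_segment a b" for z
    using mem_segment_fst[OF ab(2) that] by auto
  \<comment> \<open>The vertex \<open>a\<close> lies between \<open>p\<close> and
    \<open>g\<^sub>0\<close>, hence not above their chord, so \<open>p\<close> cannot be below the
    line of the edge.\<close>
  have d0: "0 \<le> d"
  proof -
    have "fst p < fst g\<^sub>0" using lt g0 by simp
    from sees_less_iff[OF inj this] g0 lt ab(1)
    have "(snd a - snd p) * (fst g\<^sub>0 - fst p) \<le> (snd g\<^sub>0 - snd p) * (fst a - fst p)"
      by (metis ends_in_segment(1) subsetD)
    then have "(s * (fst a - fst p) - d) * (fst g\<^sub>0 - fst p)
        \<le> (s * (fst g\<^sub>0 - fst p) - d) * (fst a - fst p)"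
      using rel g0 by simp
    then have "0 \<le> d * (fst g\<^sub>0 - fst a)" by (simp add: algebra_simps)
    then show ?thesis using g0 by (simp add: zero_le_mult_iff)
  qed
  have pg: "fst p < fst g" and pg': "fst p < fst g'" using lt bounds(1)[OF g(1)] bounds(1)[OF g'(1)] by auto
  have "(snd t - snd p) * (fst g' - fst p) \<le> (snd g' - snd p) * (fst t - fst p)"
    if t: "t \<in> T" "fst p < fst t" "fst t < fst g'" for t
  proof (cases "fst a \<le> fst t")
    case True
    then have "t \<in> closed_segment a b"
      using segment_of_inj[OF inj ab] t bounds[OF g'(1)] by simp
    then have eq: "snd t - snd p = s * (fst t - fst p) - d" by (rule rel)
    have "d * (fst t - fst p) \<le> d * (fst g' - fst p)"
      using d0 t by (simp add: mult_left_mono)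
    then show ?thesis unfolding eq rel[OF g'(1)] by (simp add: algebra_simps)
  next
    case False
    \<comment> \<open>Here \<open>t\<close> lies to the left of \<open>a\<close>, so the view of
      \<open>g\<close> bounds it. Seen from \<open>p\<close>, the slope towards an edge point at
      horizontal distance \<open>X\<close> is \<open>s - d / X\<close>, which does not decrease as
      \<open>X\<close> grows because \<open>d\<close> is nonnegative.\<close>
    define X X' D Y where "X = fst g - fst p" and "X' = fst g' - fst p"
      and "D = fst t - fst p" and "Y = snd t - snd p"
    have pos: "0 < X" "X \<le> X'" "0 < D" using pg g' t by (auto simp: X_def X'_def D_def)
    have "fst t < fst g" using False bounds(1)[OF g(1)] by simp
    then have "Y * X \<le> (s * X - d) * D"
      using sees_less_iff[OF inj pg] g t rel[OF g(1)] by (simp add: X_def D_def Y_def)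
    then have "Y * X * X' \<le> (s * X - d) * D * X'"
      using pos by (intro mult_right_mono) auto
    also have "\<dots> = s * X * D * X' - (d * D) * X'" by (simp add: algebra_simps)
    also have "\<dots> \<le> s * X * D * X' - (d * D) * X"
      using pos d0 by (intro diff_left_mono mult_left_mono) auto
    finally have "X * (Y * X') \<le> X * ((s * X' - d) * D)" by (simp add: algebra_simps)
    then have "Y * X' \<le> (s * X' - d) * D" using pos by simp
    then show ?thesis using rel[OF g'(1)] by (simp add: X'_def D_def Y_def)
  qed
  then show ?thesis
    using sees_less_iff[OF inj pg'] sees_in[OF g(2)] g' ab by blast
qed

definition mirror :: "point \<Rightarrow> point" where
  "mirror p = (- fst p, snd p)"

lemma fst_mirror [simp]: "fst (mirror p) = - fst p"
  and snd_mirror [simp]: "snd (mirror p) = snd p"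
  by (auto simp: mirror_def)

lemma closed_segment_mirror: "closed_segment (mirror p) (mirror q) = mirror ` closed_segment p q"
proof (rule closed_segment_linear_image)
  show "linear mirror"
    by (rule linearI) (auto simp: mirror_def)
qed

lemma inj_mirror: "inj mirror"
  by (auto simp: inj_def prod_eq_iff)

lemma sees_mirror: "sees (mirror ` T) (mirror p) (mirror q) \<longleftrightarrow> sees T p q"
  by (auto simp: sees_def nowhere_below_def closed_segment_mirror inj_image_mem_iff[OF inj_mirror])

text \<open>Reflection in the vertical axis preserves visibility and exchanges the ends of the edge,
  so this is \<open>sees_edge_rightwards\<close> in the mirrored terrain.\<close>

lemma sees_edge_leftwards:
  assumes inj: "inj_on fst T" and ab: "closed_segment a b \<subseteq> T" "fst a < fst b"
    and pa: "fst b \<le> fst p"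
    and g0: "g\<^sub>0 \<in> closed_segment a b" "fst g\<^sub>0 < fst b" "sees T p g\<^sub>0"
    and g: "g \<in> closed_segment a b" "sees T p g"
    and g': "g' \<in> closed_segment a b" "fst g' \<le> fst g"
  shows "sees T p g'"
proof -
  have "sees (mirror ` T) (mirror p) (mirror g')"
  proof (rule sees_edge_rightwards[where a = "mirror b" and b = "mirror a" and g\<^sub>0 = "mirror g\<^sub>0"
        and g = "mirror g"])
    show "inj_on fst (mirror ` T)"
      using inj by (auto simp: inj_on_def)
    show "closed_segment (mirror b) (mirror a) \<subseteq> mirror ` T"
      using ab by (auto simp: closed_segment_mirror closed_segment_commute)
  qed (use assms in \<open>auto simp: sees_mirror closed_segment_mirror closed_segment_commute\<close>)
  then show ?thesis by (simp add: sees_mirror)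
qed

section \<open>Combining lines of sight\<close>

text \<open>By \<open>conv\<close>, \<open>g\<close> is not above the chord from \<open>p\<close> to
  \<open>q\<close>. That chord therefore dominates the chords from \<open>p\<close> to
  \<open>g\<close> and from \<open>g\<close> to \<open>q\<close>, and these dominate the
  terrain.\<close>

lemma sees_trans_convex:
  assumes inj: "inj_on fst T" and pg: "fst p < fst g" "sees T p g"
    and gq: "fst g < fst q" "sees T g q"
    and conv: "(snd g - snd p) * (fst q - fst p) \<le> (snd q - snd p) * (fst g - fst p)"
  shows "sees T p q"
proof -
  define X D M N where "X = fst g - fst p" and "D = fst q - fst p"
    and "M = snd g - snd p" and "N = snd q - snd p"
  have pos: "0 < X" "X < D" using pg gq by (auto simp: X_def D_def)
  have c: "M * D \<le> N * X" using conv by (simp add: X_def D_def M_def N_def)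
  have "(snd t - snd p) * (fst q - fst p) \<le> (snd q - snd p) * (fst t - fst p)"
    if t: "t \<in> T" "fst p < fst t" "fst t < fst q" for t
  proof -
    define x y where "x = fst t - fst p" and "y = snd t - snd p"
    have x: "0 < x" "x < D" using t by (auto simp: x_def D_def)
    consider "fst t < fst g" | "fst t = fst g" | "fst g < fst t" by linarith
    then have "y * D \<le> N * x"
    proof cases
      case 1
      then have "y * X \<le> M * x"
        using sees_less_iff[OF inj pg(1)] pg t by (simp add: x_def y_def X_def M_def)
      then have "y * X * D \<le> M * x * D" using pos by (intro mult_right_mono) auto
      also have "\<dots> = (M * D) * x" by simp
      also have "\<dots> \<le> (N * X) * x" using c x by (intro mult_right_mono) auto
      finally have "X * (y * D) \<le> X * (N * x)" by (simp add: algebra_simps)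
      then show ?thesis using pos by simp
    next
      case 2
      then have "t = g" using inj t sees_in[OF pg(2)] by (auto dest: inj_onD)
      then show ?thesis using c by (simp add: x_def y_def X_def M_def)
    next
      case 3
      then have "(snd t - snd g) * (fst q - fst g) \<le> (snd q - snd g) * (fst t - fst g)"
        using sees_less_iff[OF inj gq(1)] gq t by simp
      then have "(y - M) * (D - X) \<le> (N - M) * (x - X)"
        by (simp add: x_def y_def X_def M_def D_def N_def)
      then have "y * (D - X) * D \<le> ((N - M) * (x - X) + M * (D - X)) * D"
        using pos x by (intro mult_right_mono) (auto simp: algebra_simps)
      also have "\<dots> = N * (x - X) * D + (M * D) * (D - x)" by (simp add: algebra_simps)
      also have "\<dots> \<le> N * (x - X) * D + (N * X) * (D - x)"
        using c x by (intro add_left_mono mult_right_mono) auto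
      also have "\<dots> = (D - X) * (N * x)" by (simp add: algebra_simps)
      finally have "(D - X) * (y * D) \<le> (D - X) * (N * x)" by (simp add: algebra_simps)
      then show ?thesis using pos by simp
    qed
    then show ?thesis by (simp add: x_def y_def D_def N_def)
  qed
  moreover have "fst p < fst q" using pg gq by simp
  ultimately show ?thesis
    using sees_less_iff[OF inj] sees_in[OF pg(2)] sees_in[OF gq(2)] by blast
qed

text \<open>Both \<open>p\<close> and \<open>q\<close> are on or above the line of the edge while
  \<open>g\<close> is on it, so the path from \<open>p\<close> through \<open>g\<close> to
  \<open>q\<close> bends upwards and \<open>sees_trans_convex\<close> applies.\<close>

lemma sees_across_edge:
  assumes inj: "inj_on fst T" and ab: "closed_segment a b \<subseteq> T" 
    and g: "g \<in> closed_segment a b" "fst a < fst g" "fst g < fst b"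
    and p: "fst p \<le> fst a" "sees T p g" and q: "fst b \<le> fst q" "sees T g q"
  shows "sees T p q"
proof (rule sees_trans_convex[OF inj _ p(2) _ q(2)])
  show pg: "fst p < fst g" and gq: "fst g < fst q" using g p q by auto
  have ltab: "fst a < fst b" using g by simp
  define s where "s = (snd b - snd a) / (fst b - fst a)"
  have line: "snd z = snd a + s * (fst z - fst a)" if "z \<in> closed_segment a b" for z
    using mem_segment_fst(3)[OF ltab that] by (simp add: s_def)
  have abT: "a \<in> T" "b \<in> T" using ab by auto
  \<comment> \<open>The chord from \<open>p\<close> to \<open>g\<close> has slope at most
    \<open>s\<close> because it passes over \<open>a\<close>. Symmetrically, the chord from
    \<open>g\<close> to \<open>q\<close> has slope at least \<open>s\<close> because it passes over
    \<open>b\<close>.\<close>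
  have left: "snd g - snd p \<le> s * (fst g - fst p)"
  proof (cases "fst p = fst a")
    case True
    then have "p = a" using inj abT sees_in[OF p(2)] by (auto dest: inj_onD)
    then show ?thesis using line[OF g(1)] by simp
  next
    case False
    then have "(snd a - snd p) * (fst g - fst p) \<le> (snd g - snd p) * (fst a - fst p)"
      using sees_less_iff[OF inj pg] p g abT by auto
    moreover have "snd a = snd g - s * (fst g - fst a)" using line[OF g(1)] by simp
    ultimately have "(fst g - fst a) * (snd g - snd p) \<le> (fst g - fst a) * (s * (fst g - fst p))"
      by (simp add: algebra_simps)
    then show ?thesis using g by simp
  qed
  have right: "s * (fst q - fst g) \<le> snd q - snd g"
  proof (cases "fst q = fst b")
    case True
    then have "q = b" using inj abT sees_in[OF q(2)] by (auto dest: inj_onD)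
    then show ?thesis using line[OF g(1)] line[of b] by (simp add: algebra_simps)
  next
    case False
    then have "(snd b - snd g) * (fst q - fst g) \<le> (snd q - snd g) * (fst b - fst g)"
      using sees_less_iff[OF inj gq] q g abT by auto
    moreover have "snd b - snd g = s * (fst b - fst g)"
      using line[OF g(1)] line[of b] by (simp add: algebra_simps)
    ultimately have "(fst b - fst g) * (s * (fst q - fst g)) \<le> (fst b - fst g) * (snd q - snd g)"
      by (simp add: algebra_simps)
    then show ?thesis using g by simp
  qed
  have "(snd g - snd p) * (fst q - fst g) \<le> s * (fst g - fst p) * (fst q - fst g)"
    using left gq by (intro mult_right_mono) auto
  also have "\<dots> = s * (fst q - fst g) * (fst g - fst p)" by simp
  also have "\<dots> \<le> (snd q - snd g) * (fst g - fst p)"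
    using right pg by (intro mult_right_mono) auto
  finally show "(snd g - snd p) * (fst q - fst p) \<le> (snd q - snd p) * (fst g - fst p)"
    by (simp add: algebra_simps)
qed

text \<open>If \<open>c\<close> were above the chord from \<open>a\<close> to \<open>d\<close>, then
  \<open>b\<close> would be lower than \<open>c\<close> and \<open>c\<close> lower than \<open>b\<close>, relative to that chord.\<close>

lemma order_claim:
  assumes inj: "inj_on fst T" and lt: "fst a < fst b" "fst b < fst c" "fst c < fst d"
    and ac: "sees T a c" and bd: "sees T b d"
  shows "sees T a d"
proof -
  define B C D where "B = fst b - fst a" and "C = fst c - fst a" and "D = fst d - fst a"
  have pos: "0 < B" "B < C" "C < D" using lt by (auto simp: B_def C_def D_def)
  \<comment> \<open>These are the heights of \<open>b\<close> and \<open>c\<close> above the chord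
    from \<open>a\<close> to \<open>d\<close>, scaled by \<open>D\<close>.\<close>
  define \<beta> \<gamma> where "\<beta> = (snd b - snd a) * D - (snd d - snd a) * B"
    and "\<gamma> = (snd c - snd a) * D - (snd d - snd a) * C"
  have "(snd b - snd a) * C \<le> (snd c - snd a) * B"
    using sees_less_iff[OF inj, of a c] ac lt sees_in[OF bd] by (auto simp: B_def C_def)
  then have "((snd b - snd a) * C) * D \<le> ((snd c - snd a) * B) * D"
    using pos by (intro mult_right_mono) auto
  then have 1: "\<beta> * C \<le> \<gamma> * B" by (simp add: \<beta>_def \<gamma>_def algebra_simps)
  have "(snd c - snd b) * (fst d - fst b) \<le> (snd d - snd b) * (fst c - fst b)"
    using sees_less_iff[OF inj, of b d] bd lt sees_in[OF ac] by auto
  then have "((snd c - snd b) * (D - B)) * D \<le> ((snd d - snd b) * (C - B)) * D"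
    using pos by (intro mult_right_mono) (auto simp: B_def C_def D_def)
  then have 2: "\<gamma> * (D - B) \<le> \<beta> * (D - C)"
    by (simp add: \<beta>_def \<gamma>_def algebra_simps)
  \<comment> \<open>If \<gamma> were positive, fact \<open>1\<close> would give \<beta> \<le>
    \<gamma>, and fact \<open>2\<close> would then give
    \<open>\<gamma> * (D - B) \<le> \<gamma> * (D - C)\<close>, contrary to
    \<open>B < C\<close>.\<close>
  have "\<gamma> \<le> 0"
  proof (rule ccontr)
    assume "\<not> \<gamma> \<le> 0"
    then have \<gamma>: "0 < \<gamma>" by simp
    have "\<gamma> * B < \<gamma> * C" using \<gamma> pos by simp
    then have "\<beta> * C \<le> \<gamma> * C" using 1 by linarith
    then have "\<beta> \<le> \<gamma>" by (rule mult_right_le_imp_le) (use pos in linarith)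
    then have "\<beta> * (D - C) \<le> \<gamma> * (D - C)" using pos by (intro mult_right_mono) auto
    also have "\<dots> < \<gamma> * (D - B)" using \<gamma> pos by simp
    finally show False using 2 by simp
  qed
  then have c: "(snd c - snd a) * D \<le> (snd d - snd a) * C" by (simp add: \<gamma>_def)
  have "(snd t - snd a) * (fst d - fst a) \<le> (snd d - snd a) * (fst t - fst a)"
    if t: "t \<in> T" "fst a < fst t" "fst t < fst d" for t
  proof -
    define x y where "x = fst t - fst a" and "y = snd t - snd a"
    have x: "0 < x" "x < D" using t by (auto simp: x_def D_def)
    consider "fst t < fst c" | "fst t = fst c" | "fst c < fst t" by linarith
    then have "y * D \<le> (snd d - snd a) * x"
    proof cases
      case 1
      then have "y * C \<le> (snd c - snd a) * x"
        using sees_less_iff[OF inj, of a c] ac lt t by (simp add: x_def y_def C_def)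
      then have "y * C * D \<le> (snd c - snd a) * x * D" using pos by (intro mult_right_mono) auto
      also have "\<dots> = ((snd c - snd a) * D) * x" by simp
      also have "\<dots> \<le> ((snd d - snd a) * C) * x" using c x by (intro mult_right_mono) auto
      finally have "C * (y * D) \<le> C * ((snd d - snd a) * x)" by (simp add: algebra_simps)
      then show ?thesis using pos by simp
    next
      case 2
      then have "t = c" using inj t sees_in[OF ac] by (auto dest: inj_onD)
      then show ?thesis using c by (simp add: x_def y_def C_def)
    next
      case 3
      then have "(snd t - snd b) * (fst d - fst b) \<le> (snd d - snd b) * (fst t - fst b)"
        using sees_less_iff[OF inj, of b d] bd lt t by simp
      then have "((snd t - snd b) * (D - B)) * D \<le> ((snd d - snd b) * (x - B)) * D"
        using pos by (intro mult_right_mono) (auto simp: x_def B_def D_def)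
      \<comment> \<open>Right of \<open>c\<close> the chord from \<open>b\<close> to
        \<open>d\<close> bounds \<open>t\<close>. It stays on or below the chord from
        \<open>a\<close> to \<open>d\<close>, since they share \<open>d\<close> and \<beta> \<le>
        0.\<close>
      then have "(y * D - (snd d - snd a) * x) * (D - B) \<le> \<beta> * (D - x)"
        by (simp add: \<beta>_def y_def algebra_simps)
      also have "\<dots> \<le> 0"
      proof -
        have "\<beta> * C \<le> 0" using 1 \<open>\<gamma> \<le> 0\<close> pos by (smt (verit) mult_nonpos_nonneg)
        then have "\<beta> \<le> 0" using pos by (simp add: mult_le_0_iff)
        then show ?thesis using x by (simp add: mult_nonpos_nonneg)
      qed
      finally have "y * D - (snd d - snd a) * x \<le> 0" using pos by (simp add: mult_le_0_iff)
      then show ?thesis by simp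
    qed
    then show ?thesis by (simp add: x_def y_def D_def)
  qed
  moreover have "fst a < fst d" using lt by simp
  ultimately show ?thesis
    using sees_less_iff[OF inj] sees_in[OF ac] sees_in[OF bd] by blast
qed

section \<open>Visibility regions are closed\<close>

text \<open>Treating both orders of \<open>p\<close> and \<open>q\<close> in one formula describes
  the whole region seen from \<open>p\<close> by one condition per terrain point; the conjunct for
  the wrong order is vacuous.\<close>

lemma sees_iff:
  assumes inj: "inj_on fst T"
  shows "sees T p q \<longleftrightarrow> p \<in> T \<and> q \<in> T \<and>
    (\<forall>t\<in>T. (fst p < fst t \<and> fst t < fst q \<longrightarrow>
         (snd t - snd p) * (fst q - fst p) \<le> (snd q - snd p) * (fst t - fst p)) \<and>
       (fst q < fst t \<and> fst t < fst p \<longrightarrow>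
         (snd t - snd q) * (fst p - fst q) \<le> (snd p - snd q) * (fst t - fst q)))"
    (is "_ \<longleftrightarrow> ?R")
proof -
  consider "fst p < fst q" | "fst p = fst q" | "fst q < fst p" by linarith
  then show ?thesis
  proof cases
    case 1
    then show ?thesis using sees_less_iff[OF inj 1] by auto
  next
    case 2
    show ?thesis
    proof
      assume ?R
      moreover from this have "p = q" using inj 2 by (auto dest: inj_onD)
      ultimately show "sees T p q" using sees_refl[OF inj] by simp
    qed (use 2 in \<open>auto simp: sees_def\<close>)
  next
    case 3
    then show ?thesis using sees_less_iff[OF inj 3] sees_commute[of T p q] by auto
  qed
qed

lemma closed_visibility:
  assumes inj: "inj_on fst T" and cl: "closed T"
  shows "closed (visibility T p)"
proof (cases "p \<in> T")
  case True
  \<comment> \<open>\<open>R t\<close> and \<open>L t\<close> contain the points that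
    \<open>t\<close> does not hide from \<open>p\<close> on either side. For fixed \<open>t\<close>,
    negating the strict premise on \<open>q\<close> gives a non-strict alternative, so each is a
    union of closed sets.\<close>
  define R where "R t = {q. fst p < fst t \<and> fst t < fst q \<longrightarrow>
         (snd t - snd p) * (fst q - fst p) \<le> (snd q - snd p) * (fst t - fst p)}" for t
  define L where "L t = {q. fst q < fst t \<and> fst t < fst p \<longrightarrow>
         (snd t - snd q) * (fst p - fst q) \<le> (snd p - snd q) * (fst t - fst q)}" for t
  have "closed (R t)" for t
    unfolding R_def
    by (cases "fst p < fst t")
      (auto simp: imp_conv_disj not_less intro!: closed_Collect_disj closed_Collect_le continuous_intros)
  moreover have "closed (L t)" for t
    unfolding L_def
    by (cases "fst t < fst p")
      (auto simp: imp_conv_disj not_less intro!: closed_Collect_disj closed_Collect_le continuous_intros)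
  moreover have "visibility T p = T \<inter> (\<Inter>t\<in>T. R t \<inter> L t)"
    using True by (auto simp: visibility_def sees_iff[OF inj] R_def L_def)
  ultimately show ?thesis using cl by (metis (no_types, lifting) closed_INT closed_Int)
next
  case False
  then show ?thesis by (simp add: visibility_def sees_def)
qed

section \<open>Terrains as graphs with vertices and edges\<close>

text \<open>The vertex list is replaced by the geometric facts that the argument uses. Injectivity
  of \<open>fst\<close> expresses monotonicity, edges are pairs with the left endpoint first, and
  \<open>V_outside\<close> keeps vertices out of the open range of an edge.\<close>

locale terrain_graph =
  fixes T V :: "point set" and E :: "(point \<times> point) set"
  assumes inj: "inj_on fst T"
    and closed: "closed T"
    and finite_V: "finite V"
    and V_sub: "V \<subseteq> T"
    and E_V: "(a, b) \<in> E \<Longrightarrow> a \<in> V \<and> b \<in> V \<and> fst a < fst b \<and> closed_segment a b \<subseteq> T"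
    and T_cover: "t \<in> T \<Longrightarrow> t \<notin> V \<Longrightarrow> \<exists>(a, b)\<in>E. t \<in> closed_segment a b"
    and V_outside: "(a, b) \<in> E \<Longrightarrow> v \<in> V \<Longrightarrow> fst v \<le> fst a \<or> fst b \<le> fst v"
begin

definition candidates :: "point set" where
  "candidates = V \<union> (\<Union>v\<in>V. {p. extremal T v p})"

lemma candidates_sub: "candidates \<subseteq> T"
  using V_sub by (auto simp: candidates_def extremal_def visibility_def)

lemma interior_edge:
  assumes "t \<in> T" "t \<notin> V"
  obtains a b where "(a, b) \<in> E" "t \<in> closed_segment a b" "fst a < fst t" "fst t < fst b"
proof -
  obtain a b where ab: "(a, b) \<in> E" "t \<in> closed_segment a b" using T_cover[OF assms] by auto
  have e: "a \<in> V" "b \<in> V" "fst a < fst b" using E_V[OF ab(1)] by auto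
  have "fst t \<noteq> fst a" "fst t \<noteq> fst b"
    using assms e V_sub inj by (metis inj_onD subsetD)+
  then show ?thesis
    using that[OF ab] mem_segment_fst[OF e(3) ab(2)] by simp
qed

section \<open>Candidates on an edge\<close>

text \<open>The part of the edge seen from \<open>v\<close> is compact, and \<open>u\<close> is its
  leftmost point: either the vertex \<open>a\<close> or an extremal point of the view of
  \<open>v\<close>.\<close>

lemma candidate_on_edge:
  assumes ab: "(a, b) \<in> E" and g: "g \<in> closed_segment a b" and v: "v \<in> V" "sees T v g"
  obtains u where "u \<in> candidates" "u \<in> closed_segment a b" "fst u \<le> fst g" "sees T v u"
proof -
  have e: "a \<in> V" "b \<in> V" "fst a < fst b" "closed_segment a b \<subseteq> T" using E_V[OF ab] by auto
  define K where "K = visibility T v \<inter> closed_segment a b"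
  have gK: "g \<in> K" using g v sees_in[OF v(2)] by (auto simp: K_def visibility_def)
  have "compact K"
    unfolding K_def by (intro closed_Int_compact closed_visibility inj closed compact_segment)
  moreover have "continuous_on K fst" by (intro continuous_intros)
  ultimately obtain u where u: "u \<in> K" and min: "\<And>z. z \<in> K \<Longrightarrow> fst u \<le> fst z"
    using continuous_attains_inf[of K fst] gK by blast
  have uT: "u \<in> visibility T v" "u \<in> closed_segment a b" using u by (auto simp: K_def)
  have "u \<in> candidates"
  proof (cases "u = a")
    case True
    then show ?thesis using e by (simp add: candidates_def)
  next
    case False
    have "fst u \<noteq> fst a"
      using False inj uT(2) e by (metis inj_onD subsetD ends_in_segment(1))
    then have au: "fst a < fst u" and ub: "fst u \<le> fst b" using mem_segment_fst[OF e(3) uT(2)] by auto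
    let ?K = "connected_component_set (visibility T v) u"
    have "fst u \<le> fst r" if r: "r \<in> ?K" for r
    proof (rule ccontr)
      assume "\<not> fst u \<le> fst r"
      then have ru: "fst r < fst u" by simp
      \<comment> \<open>The projection of the component is an interval and contains
        \<open>x\<close>. Taking the midpoint into the maximum keeps \<open>x\<close> right of
        \<open>a\<close>, so the component point over \<open>x\<close> lies on the edge and
        contradicts minimality of \<open>u\<close>.\<close>
      define x where "x = max ((fst a + fst u) / 2) (fst r)"
      have x: "fst a < x" "x < fst u" "fst r \<le> x" using au ru by (auto simp: x_def less_max_iff_disj)
      have "connected (fst ` ?K)"
        by (intro connected_continuous_image continuous_intros connected_connected_component)
      moreover have "fst r \<in> fst ` ?K" "fst u \<in> fst ` ?K"
        using r uT by (auto simp: connected_component_refl)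
      ultimately have "x \<in> fst ` ?K" using x by (meson connectedD_interval less_imp_le)
      then obtain z where z: "z \<in> ?K" "fst z = x" by auto
      then have zv: "z \<in> visibility T v" using connected_component_subset by blast
      moreover have "z \<in> closed_segment a b"
        by (rule segment_of_inj[OF inj e(4,3)]) (use zv z x ub in \<open>auto simp: visibility_def\<close>)
      ultimately show False using min[of z] z x by (auto simp: K_def)
    qed
    then have "extremal T v u" using uT by (auto simp: extremal_def)
    then show ?thesis using v by (auto simp: candidates_def)
  qed
  then show ?thesis
    using that[of u] uT min[OF gK] by (auto simp: visibility_def)
qed

text \<open>\<open>candidate_on_edge\<close> supplies a candidate for each left vertex that sees
  \<open>g\<close>. The endpoint \<open>a\<close> is added so that a choice remains when there is no
  such vertex.\<close>

lemma left_candidate: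
  assumes ab: "(a, b) \<in> E" and g: "g \<in> closed_segment a b" "fst a < fst g"
  obtains l where "l \<in> candidates" "l \<in> closed_segment a b" "fst l \<le> fst g"
    "\<And>v. v \<in> V \<Longrightarrow> fst v \<le> fst a \<Longrightarrow> sees T v g \<Longrightarrow> sees T v l"
proof -
  have e: "a \<in> V" "b \<in> V" "fst a < fst b" "closed_segment a b \<subseteq> T" using E_V[OF ab] by auto
  define W where "W = {v\<in>V. fst v \<le> fst a \<and> sees T v g}"
  have "\<forall>v\<in>W. \<exists>u. u \<in> candidates \<and> u \<in> closed_segment a b \<and> fst u \<le> fst g \<and> sees T v u"
    using candidate_on_edge[OF ab g(1)] by (metis (no_types, lifting) W_def mem_Collect_eq)
  then obtain u where u: "\<And>v. v \<in> W \<Longrightarrow> u v \<in> candidates \<and> u v \<in> closed_segment a b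
      \<and> fst (u v) \<le> fst g \<and> sees T v (u v)"
    by metis
  \<comment> \<open>the views of left vertices are closed under moving right, so the rightmost \<open>u v\<close> serves all\<close>
  define F where "F = insert a (u ` W)"
  have F: "finite F" "F \<noteq> {}" using finite_V by (auto simp: F_def W_def)
  define l where "l = arg_max_on fst F"
  have l: "l \<in> F" "\<And>z. z \<in> F \<Longrightarrow> fst z \<le> fst l"
  proof -
    \<comment> \<open>\<open>arg_max_on\<close> is a choice operator, so an actual maximiser must be
      exhibited first.\<close>
    have "Max (fst ` F) \<in> fst ` F" using F by simp
    then obtain m where m: "m \<in> F" "fst m = Max (fst ` F)" by auto
    have "is_arg_max fst (\<lambda>x. x \<in> F) m"
      using m F by (auto simp: is_arg_max_linorder)
    then have "is_arg_max fst (\<lambda>x. x \<in> F) l"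
      unfolding l_def arg_max_on_def arg_max_def by (rule someI)
    then show "l \<in> F" "\<And>z. z \<in> F \<Longrightarrow> fst z \<le> fst l" by (auto simp: is_arg_max_linorder)
  qed
  have lc: "l \<in> candidates" "l \<in> closed_segment a b" "fst l \<le> fst g"
    using l(1) u e g by (auto simp: F_def candidates_def)
  have "sees T v l" if v: "v \<in> V" "fst v \<le> fst a" "sees T v g" for v
  proof -
    have "v \<in> W" using v by (simp add: W_def)
    then show ?thesis
      using sees_edge_rightwards[OF inj e(4,3) v(2) g v(3), of "u v" l] u lc l(2)
      by (auto simp: F_def)
  qed
  then show ?thesis using that lc by blast
qed

lemma guard_cover_iff: "guard_cover T G \<longleftrightarrow> G \<subseteq> T \<and> (\<forall>t\<in>T. \<exists>g\<in>G. sees T g t)"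
  by (fastforce simp: guard_cover_def visibility_def)

section \<open>Exchanging a single guard\<close>

text \<open>The witness is the left candidate \<open>l\<close> if it restores a cover, and otherwise
  the right endpoint \<open>b\<close> of the edge of \<open>g\<close>.\<close>

lemma replace_guard:
  assumes fin: "finite C" and cov: "guard_cover T C" and gC: "g \<in> C" and gV: "g \<notin> V"
  shows "\<exists>u\<in>candidates. guard_cover T (insert u (C - {g}))"
proof -
  have CT: "C \<subseteq> T" and seen: "\<And>t. t \<in> T \<Longrightarrow> \<exists>h\<in>C. sees T h t"
    using cov by (auto simp: guard_cover_iff)
  have gT: "g \<in> T" using gC CT by auto
  obtain a b where ab: "(a, b) \<in> E" and g: "g \<in> closed_segment a b" "fst a < fst g" "fst g < fst b"
    using interior_edge[OF gT gV] .
  have e: "a \<in> V" "b \<in> V" "fst a < fst b" "closed_segment a b \<subseteq> T" using E_V[OF ab] by auto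
  obtain l where l: "l \<in> candidates" "l \<in> closed_segment a b" "fst l \<le> fst g"
    and lV: "\<And>v. v \<in> V \<Longrightarrow> fst v \<le> fst a \<Longrightarrow> sees T v g \<Longrightarrow> sees T v l"
    using left_candidate[OF ab g(1,2)] by blast
  have lT: "l \<in> T" using l candidates_sub by auto
  show ?thesis
  proof (cases "guard_cover T (insert l (C - {g}))")
    case True
    then show ?thesis using l by auto
  next
    case False
    then obtain q where qT: "q \<in> T" and ql: "\<not> sees T l q"
      and qC: "\<And>h. h \<in> C \<Longrightarrow> h \<noteq> g \<Longrightarrow> \<not> sees T h q"
      using CT lT by (auto simp: guard_cover_iff)
    have gq: "sees T g q" using seen[OF qT] qC by auto
    then have qg: "sees T q g" by (simp add: sees_commute)
    \<comment> \<open>Points over the edge itself are seen by \<open>l\<close>, and points beyond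
      \<open>b\<close> stay visible when the guard moves left.\<close>
    have qa: "fst q < fst a"
    proof (rule ccontr)
      assume "\<not> fst q < fst a"
      then consider "fst a \<le> fst q" "fst q \<le> fst b" | "fst b < fst q" by linarith
      then show False
      proof cases
        case 1
        then have "q \<in> closed_segment a b" using segment_of_inj[OF inj e(4,3) qT] by simp
        then show False using sees_same_edge[OF inj e(4) l(2)] ql by simp
      next
        case 2
        have "sees T q l"
          by (rule sees_edge_leftwards[OF inj e(4,3) _ g(1,3) _ g(1) _ l(2,3)])
            (use 2 qg g in auto)
        then show False using ql sees_commute by blast
      qed
    qed
    \<comment> \<open>The choice of \<open>l\<close> keeps every left vertex that \<open>g\<close>
      sees, so the lost point is interior to an edge.\<close>
    have "q \<notin> V" using lV[of q] qa gq ql sees_commute by (metis less_imp_le)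
    then obtain c d where cd: "(c, d) \<in> E"
      and q: "q \<in> closed_segment c d" "fst c < fst q" "fst q < fst d"
      using interior_edge[OF qT] by blast
    have f: "c \<in> V" "d \<in> V" "fst c < fst d" "closed_segment c d \<subseteq> T" using E_V[OF cd] by auto
    have da: "fst d \<le> fst a" using V_outside[OF cd e(1)] q qa by linarith
    have al: "fst a \<le> fst l" using mem_segment_fst[OF e(3) l(2)] by simp
    \<comment> \<open>If \<open>g\<close> saw \<open>d\<close>, then \<open>l\<close> would see both
      \<open>c\<close> and \<open>d\<close>. Seeing \<open>c\<close> puts \<open>l\<close> on or
      above the line of this edge, so its view of \<open>d\<close> would extend left to
      \<open>q\<close>.\<close>
    have gd: "\<not> sees T g d"
    proof
      assume gd: "sees T g d"
      have "sees T g c"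
        by (rule sees_edge_leftwards[OF inj f(4,3) _ q(1,3) gq q(1) gq]) (use da g q in auto)
      then have "sees T l c" using lV[of c] f da sees_commute by auto
      moreover have "sees T l d" using lV[of d] f da gd sees_commute by auto
      ultimately have "sees T l q"
        by (intro sees_edge_leftwards[OF inj f(4,3) _ _ _ _ _ _ q(1), of l c d])
          (use da al f q in auto)
      then show False using ql by simp
    qed
    \<comment> \<open>\<open>S\<close> runs from \<open>q\<close> to \<open>d\<close> without
      \<open>d\<close>: seeing an edge point other than \<open>d\<close> from the right of the edge
      forces the view to extend leftwards, which seeing \<open>d\<close> alone does not.\<close>
    define S where "S = (\<lambda>s. q + s *\<^sub>R (d - q)) ` {0..<1::real}"
    define H where "H = {h\<in>C. h \<noteq> g \<and> fst h < fst c}"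
    define B where "B = (\<Union>h\<in>H. visibility T h)"
    have qd: "closed_segment q d \<subseteq> closed_segment c d"
      using q by (simp add: closed_segment_subset)
    have S: "z \<in> closed_segment c d" "fst q \<le> fst z" "fst z < fst d" if "z \<in> S" for z
    proof -
      obtain s where s: "z = q + s *\<^sub>R (d - q)" "0 \<le> s" "s < 1"
        using \<open>z \<in> S\<close> unfolding S_def by fastforce
      then have "z \<in> closed_segment q d"
        by (auto simp: closed_segment_def algebra_simps intro!: exI[of _ s])
      then show "z \<in> closed_segment c d" using qd by auto
      have fz: "fst z = fst q + s * (fst d - fst q)" using s(1) by simp
      have "0 < (1 - s) * (fst d - fst q)" using s(3) q by simp
      then show "fst z < fst d" unfolding fz by (simp add: algebra_simps)
      show "fst q \<le> fst z" unfolding fz using s(2) q by simp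
    qed
    have "connected S"
      unfolding S_def by (intro connected_continuous_image continuous_intros) (auto simp: connected_Ico)
    moreover have "closed (visibility T g)" by (intro closed_visibility inj closed)
    moreover have "closed B"
      unfolding B_def by (intro closed_UN ballI closed_visibility inj closed) (simp add: H_def fin)
    moreover have SAB: "S \<subseteq> visibility T g \<union> B"
    proof
      fix z assume z: "z \<in> S"
      have zT: "z \<in> T" using S[OF z] f by auto
      then obtain h where h: "h \<in> C" "sees T h z" using seen by blast
      \<comment> \<open>A guard other than \<open>g\<close> that is not left of \<open>c\<close> and
        sees a point of \<open>S\<close> would also see \<open>q\<close>.\<close>
      have "h \<in> H" if "h \<noteq> g"
      proof (rule ccontr)
        assume "h \<notin> H"
        then have ch: "fst c \<le> fst h" using h that by (auto simp: H_def)
        have "sees T h q"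
        proof (cases "fst h \<le> fst d")
          case True
          then have "h \<in> closed_segment c d" using segment_of_inj[OF inj f(4,3)] h ch CT True by blast
          then show ?thesis using sees_same_edge[OF inj f(4)] q by simp
        next
          case False
          show ?thesis
            by (rule sees_edge_leftwards[OF inj f(4,3) _ S(1,3)[OF z] h(2) S(1)[OF z] h(2) q(1) S(2)[OF z]])
              (use False in simp)
        qed
        then show False using qC h that by blast
      qed
      then show "z \<in> visibility T g \<union> B" using h zT unfolding visibility_def B_def by blast
    qed
    moreover have "visibility T g \<inter> S \<noteq> {}"
    proof -
      have "q \<in> S" by (auto simp: S_def intro!: image_eqI[of _ _ 0])
      then show ?thesis using gq qT by (auto simp: visibility_def)
    qed
    \<comment> \<open>Otherwise \<open>g\<close> would see all of \<open>S\<close>, and by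
      closedness also its limit \<open>d\<close>.\<close>
    moreover have "B \<inter> S \<noteq> {}"
    proof
      assume "B \<inter> S = {}"
      then have "S \<subseteq> visibility T g" using SAB by auto
      then have "closure S \<subseteq> visibility T g"
        by (simp add: closure_minimal closed_visibility inj closed)
      moreover have "d \<in> closure S"
      proof -
        have "(\<lambda>s. q + s *\<^sub>R (d - q)) ` closure {0..<1::real} \<subseteq> closure S"
          by (rule image_closure_subset)
            (auto simp: S_def intro!: continuous_intros closure_subset[THEN subsetD])
        moreover have "d = q + 1 *\<^sub>R (d - q)" by simp
        moreover have "1 \<in> closure {0..<1::real}" by simp
        ultimately show ?thesis by (metis image_subset_iff)
      qed
      ultimately show False using gd by (auto simp: visibility_def)
    qed
    \<comment> \<open>The connected set \<open>S\<close> is covered by two closed sets that both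
      meet it, so they share a point in it. \<open>B\<close> is closed as a finite union.\<close>
    ultimately obtain m where m: "m \<in> visibility T g" "m \<in> B" "m \<in> S"
      unfolding connected_closed by blast
    then obtain h where h: "h \<in> C" "h \<noteq> g" "fst h < fst c" "sees T h m"
      unfolding B_def H_def visibility_def by blast
    have "m \<noteq> q" using h qC by blast
    moreover have "m \<in> T" using m by (auto simp: visibility_def)
    ultimately have "fst m \<noteq> fst q" using inj qT by (auto dest: inj_onD)
    then have qm: "fst q < fst m" using S(2)[OF m(3)] by simp
    have right: "sees T h z" if z: "sees T g z" "fst b \<le> fst z" for z
    proof (rule order_claim[OF inj _ qm _ h(4)])
      show "fst h < fst q" using h q by simp
      show "fst m < fst z" using S(3)[OF m(3)] da e z by simp
      show "sees T q z"
        by (rule sees_across_edge[OF inj e(4) g _ _ z(2,1)]) (use qa qg in auto)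
    qed
    have "\<exists>u\<in>insert b (C - {g}). sees T u z" if z: "z \<in> T" for z
    proof -
      obtain k where k: "k \<in> C" "sees T k z" using seen z by blast
      show ?thesis
      proof (cases "k = g")
        case True
        then have zg: "sees T z g" using k by (simp add: sees_commute)
        \<comment> \<open>Of the points that \<open>g\<close> saw, \<open>b\<close> takes over those
          left of and on the edge, and \<open>h\<close>, which stays in the guard set, those beyond
          it.\<close>
        consider "fst z < fst a" | "fst a \<le> fst z" "fst z \<le> fst b" | "fst b < fst z" by linarith
        then show ?thesis
        proof cases
          case 1
          have "sees T z b"
            by (rule sees_edge_rightwards[OF inj e(4,3) _ g(1,2) _ g(1)])
              (use 1 zg g in auto)
          then show ?thesis using sees_commute by blast
        next
          case 2
          then show ?thesis
            using sees_same_edge[OF inj e(4)] segment_of_inj[OF inj e(4,3) z] by auto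
        next
          case 3
          then show ?thesis using right[of z] True k h by auto
        qed
      qed (use k in auto)
    qed
    then have "guard_cover T (insert b (C - {g}))"
      using CT e V_sub by (auto simp: guard_cover_iff)
    then show ?thesis using e by (auto simp: candidates_def)
  qed
qed

section \<open>Exchanging all guards and adjusting the cardinality\<close>

text \<open>Each exchange lowers the number of guards outside \<open>candidates\<close>. The
  cardinality may drop, since the new guard may already be present.\<close>

lemma cover_by_candidates:
  assumes "finite C" "guard_cover T C"
  shows "\<exists>C'\<subseteq>candidates. finite C' \<and> guard_cover T C' \<and> card C' \<le> card C"
  using assms
proof (induction "card (C - candidates)" arbitrary: C rule: less_induct)
  case less
  show ?case
  proof (cases "C \<subseteq> candidates")
    case False
    then obtain g where g: "g \<in> C" "g \<notin> candidates" by auto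
    then have "g \<notin> V" by (auto simp: candidates_def)
    then obtain u where u: "u \<in> candidates" "guard_cover T (insert u (C - {g}))"
      using replace_guard[OF less.prems g(1)] by auto
    have "insert u (C - {g}) - candidates \<subset> C - candidates" using u g by auto
    then have "card (insert u (C - {g}) - candidates) < card (C - candidates)"
      using less.prems by (intro psubset_card_mono) auto
    then obtain C' where "C' \<subseteq> candidates" "finite C'" "guard_cover T C'"
      "card C' \<le> card (insert u (C - {g}))"
      using less.hyps[of "insert u (C - {g})"] u less.prems by auto
    moreover have "card (insert u (C - {g})) \<le> card C"
      using g less.prems by (metis card_insert_le_m1 card_gt_0_iff card_Diff_singleton le_refl empty_iff)
    ultimately show ?thesis by (meson le_trans)
  qed (use less.prems in blast)
qed

text \<open>Adding candidates preserves a cover, so lost cardinality can be restored while enough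
  candidates exist. The premise \<open>finite candidates\<close> guards the comparison because
  \<open>card\<close> is 0 on infinite sets.\<close>

lemma cover_by_candidates_card:
  assumes "finite C" "guard_cover T C"
  shows "\<exists>C'\<subseteq>candidates. finite C' \<and> guard_cover T C' \<and> card C' \<le> card C \<and>
    ((finite candidates \<longrightarrow> card C \<le> card candidates) \<longrightarrow> card C' = card C)"
proof -
  obtain D where D: "D \<subseteq> candidates" "finite D" "guard_cover T D" "card D \<le> card C"
    using cover_by_candidates[OF assms] by auto
  show ?thesis
  proof (cases "finite candidates \<longrightarrow> card C \<le> card candidates")
    case True
    obtain C' where C': "D \<subseteq> C'" "C' \<subseteq> candidates" "finite C'" "card C' = card C"
    proof (cases "finite candidates")
      case fin: True
      then show ?thesis
        using exists_subset_between[of D "card C" candidates] D True that by (metis finite_subset)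
    next
      case False
      then have "infinite (candidates - D)" using D by simp
      then obtain X where "finite X" "card X = card C - card D" "X \<subseteq> candidates - D"
        using infinite_arbitrarily_large by metis
      moreover from this have "card (D \<union> X) = card D + card X"
        using D by (intro card_Un_disjoint) auto
      ultimately show ?thesis using that[of "D \<union> X"] D by auto
    qed
    then have "guard_cover T C'"
      using D candidates_sub unfolding guard_cover_iff by blast
    then show ?thesis using C' by auto
  qed (use D in blast)
qed

end

section \<open>Vertex lists yield terrain graphs\<close>

lemma terrain_graph_terrain:
  assumes "terrain_vertices vs"
  shows "terrain_graph (terrain vs) (set vs) {(vs ! i, vs ! Suc i) | i. i < length vs - 1}"
proof -
  have mono: "fst (vs ! i) < fst (vs ! j)" if "i < j" "j < length vs" for i j
    using assms that by (auto simp: terrain_vertices_def sorted_wrt_iff_nth_less)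
  then have mono': "fst (vs ! i) \<le> fst (vs ! j)" if "i \<le> j" "j < length vs" for i j
    using that by (metis le_neq_implies_less less_imp_le order_refl)
  have outside: "fst (vs ! k) \<le> fst (vs ! i) \<or> fst (vs ! Suc i) \<le> fst (vs ! k)"
    if "i < length vs - 1" "k < length vs" for i k
    using that mono'[of k i] mono'[of "Suc i" k] by (cases "k \<le> i") auto
  have seg: "fst (vs ! i) \<le> fst z" "fst z \<le> fst (vs ! Suc i)" "fst z = fst (vs ! i) \<Longrightarrow> z = vs ! i"
    "fst z = fst (vs ! Suc i) \<Longrightarrow> z = vs ! Suc i"
    if "i < length vs - 1" "z \<in> closed_segment (vs ! i) (vs ! Suc i)" for i z
  proof -
    have lt: "fst (vs ! i) < fst (vs ! Suc i)" using mono that(1) by simp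
    note m = mem_segment_fst[OF lt that(2)]
    show "fst (vs ! i) \<le> fst z" "fst z \<le> fst (vs ! Suc i)" using m by auto
    show "z = vs ! i" if "fst z = fst (vs ! i)"
      using m(3) that by (simp add: prod_eq_iff)
    show "z = vs ! Suc i" if "fst z = fst (vs ! Suc i)"
      using m(3) that lt by (simp add: prod_eq_iff)
  qed
  have vertex_edge: "p = q" if i: "i < length vs - 1" "q \<in> closed_segment (vs ! i) (vs ! Suc i)"
    and p: "p \<in> set vs" "fst p = fst q" for p q i
  proof -
    obtain k where k: "k < length vs" "p = vs ! k" using p(1) by (auto simp: in_set_conv_nth)
    have il: "i < length vs" using i(1) by simp
    show ?thesis
    proof (cases "k \<le> i")
      case True
      then have "fst (vs ! k) = fst (vs ! i)"
        using mono'[of k i] seg(1)[OF i] i(1) k p(2) by simp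
      moreover have "k = i" using calculation True mono[of k i] il by (cases "k = i") auto
      ultimately show ?thesis using seg(3)[OF i] k p(2) by simp
    next
      case False
      then have "fst (vs ! k) = fst (vs ! Suc i)"
        using mono'[of "Suc i" k] seg(2)[OF i] i(1) k p(2) by simp
      moreover have "k = Suc i" using calculation False mono[of "Suc i" k] k(1) by (cases "k = Suc i") auto
      ultimately show ?thesis using seg(4)[OF i] k p(2) by simp
    qed
  qed
  have edge_edge: "p = q"
    if "i \<le> j" "j < length vs - 1" "p \<in> closed_segment (vs ! i) (vs ! Suc i)"
      "q \<in> closed_segment (vs ! j) (vs ! Suc j)" "fst p = fst q" for p q i j
  proof (cases "i = j")
    case True
    have "fst (vs ! j) < fst (vs ! Suc j)" using mono that(2) by simp
    then show ?thesis
      using mem_segment_fst(3)[of "vs ! j" "vs ! Suc j" p] mem_segment_fst(3)[of "vs ! j" "vs ! Suc j" q]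
        that True by (auto simp: prod_eq_iff)
  next
    case False
    have i: "i < length vs - 1" using that by simp
    \<comment> \<open>Distinct edges can share a first coordinate only at the left end of the later
      one, so \<open>q\<close> is a vertex and \<open>vertex_edge\<close> applies.\<close>
    have "fst (vs ! Suc i) \<le> fst (vs ! j)" using mono'[of "Suc i" j] False that by simp
    then have "fst q = fst (vs ! j)"
      using seg(2)[OF i that(3)] seg(1)[OF that(2,4)] that(5) by simp
    then have "q = vs ! j" using seg(3)[OF that(2,4)] by simp
    then show ?thesis using vertex_edge[OF i that(3), of q] that by (simp add: nth_mem)
  qed
  have vertex_vertex: "p = q" if "p \<in> set vs" "q \<in> set vs" "fst p = fst q" for p q
    using that mono by (metis in_set_conv_nth less_irrefl nat_neq_iff)
  show ?thesis
  proof
    show "inj_on fst (terrain vs)"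
    proof (rule inj_onI)
      fix p q assume "p \<in> terrain vs" "q \<in> terrain vs" and eq: "fst p = fst q"
      then consider "p \<in> set vs" "q \<in> set vs"
        | i where "p \<in> set vs" "i < length vs - 1" "q \<in> closed_segment (vs ! i) (vs ! Suc i)"
        | i where "q \<in> set vs" "i < length vs - 1" "p \<in> closed_segment (vs ! i) (vs ! Suc i)"
        | i j where "i < length vs - 1" "p \<in> closed_segment (vs ! i) (vs ! Suc i)"
            "j < length vs - 1" "q \<in> closed_segment (vs ! j) (vs ! Suc j)"
        by (auto simp: terrain_def)
      then show "p = q"
      proof cases
        case (4 i j)
        then show ?thesis
          using edge_edge[of i j p q] edge_edge[of j i q p] eq by (metis nat_le_linear)
      qed (use vertex_vertex vertex_edge eq in metis)+
    qed
    show "closed (terrain vs)"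
      unfolding terrain_def by (intro closed_Un closed_UN finite_imp_closed) auto
    show "set vs \<subseteq> terrain vs" by (simp add: terrain_def)
    show "a \<in> set vs \<and> b \<in> set vs \<and> fst a < fst b \<and> closed_segment a b \<subseteq> terrain vs"
      if "(a, b) \<in> {(vs ! i, vs ! Suc i) |i. i < length vs - 1}" for a b
      using that mono by (auto simp: terrain_def)
    show "\<exists>(a, b)\<in>{(vs ! i, vs ! Suc i) |i. i < length vs - 1}. t \<in> closed_segment a b"
      if "t \<in> terrain vs" "t \<notin> set vs" for t
      using that unfolding terrain_def by blast
    show "fst v \<le> fst a \<or> fst b \<le> fst v"
      if "(a, b) \<in> {(vs ! i, vs ! Suc i) |i. i < length vs - 1}" "v \<in> set vs" for a b v
      using that outside by (auto simp: in_set_conv_nth)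
  qed simp
qed

theorem theorem15:
  fixes vs :: "point list" and C :: "point set"
  assumes "terrain_vertices vs"
    and "finite C"
    and "guard_cover (terrain vs) C"
  shows "\<exists>C'. C' \<subseteq> guard_candidates vs \<and> finite C' \<and> guard_cover (terrain vs) C' \<and>
           card C' \<le> card C \<and>
           ((finite (guard_candidates vs) \<longrightarrow> card C \<le> card (guard_candidates vs)) \<longrightarrow>
              card C' = card C)"
proof -
  interpret terrain_graph "terrain vs" "set vs" "{(vs ! i, vs ! Suc i) |i. i < length vs - 1}"
    using assms(1) by (rule terrain_graph_terrain)
  have "guard_candidates vs = candidates" by (simp add: guard_candidates_def candidates_def)
  then show ?thesis using cover_by_candidates_card[OF assms(2,3)] by auto
qed

end
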